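(* Let $\mathcal F$ be a tribe of fuzzy sets of a set $\Omega\neq\emptyset$, and let $\mathcal S=\{A\subseteq\Omega\mid \chi_A\in\mathcal F\}$. The following statements are equivalent: (i) For each $f\in\mathcal F$, $(f+1)/2$ belongs to $\mathcal F$. (ii) The MV-algebra of dyadic numbers in $[0,1]$ can be embedded into $\mathcal F$ (as an MV-algebra). (iii) $\mathcal F$ contains all constant functions $\Omega\to[0,1]$. (iv) $\mathcal F$ contains all $\mathcal S$-measurable functions $\Omega\to[0,1]$. (v) $\mathcal F$ is divisible. In either case, $s(f)=(f+1)/2$, $f\in\mathcal F$, is a square root on $\mathcal F$, and $\mathcal F$ is strict.
   Context: A tribe is a system $\mathcal F\subseteq[0,1]^\Omega$ of fuzzy sets on a non-empty set $\Omega$ such that (i) $0_\Omega\in\mathcal F$; (ii) $f\in\mathcal F$ implies $1-f\in\mathcal F$; (iii) if $f_n\in\mathcal F$ for $n\ge1$, then $\bigoplus_{n=1}^\infty f_n:=\min\{\sum_{n=1}^\infty f_n,1\}\in\mathcal F$ (pointwise). A tribe is an MV-algebra under the pointwise operations $f\oplus g=\min\{f+g,1\}$, $f'=1-f$; $f\odot g=(f'\oplus g')'$. The system $\mathcal S$ is known to be a $\sigma$-algebra of subsets of $\Omega$. The MV-algebra of dyadic numbers is $\{i/2^n\mid n\ge1,\ 0\le i\le 2^n\}$ with $x\oplus y=\min\{x+y,1\}$, $x'=1-x$. An MV-algebra $M$ is divisible if for each $x\in M$ and integer $n\ge1$ there is $y\in M$ with $n.y=x$ and $((n-1).y)\odot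 y=0$, where $0.y=0$, $n.y=(n-1).y\oplus y$. A square root on an MV-algebra $M$ is a map $s:M\to M$ with $s(x)\odot s(x)=x$ for all $x$ and such that $y\odot y\le x$ implies $y\le s(x)$; $M$ is strict if it has a square root $s$ with $s(0)=s(0)'$. *)

theory Defs
  imports "HOL-Analysis.Analysis" "HOL-Algebra.Congruence"
begin

section \<open>MV-algebras\<close>

record 'a mv = "'a partial_object" +
  mv_plus :: "'a \<Rightarrow> 'a \<Rightarrow> 'a"
  mv_neg :: "'a \<Rightarrow> 'a"
  mv_zero :: "'a"

definition mv_one :: "('a, 'm) mv_scheme \<Rightarrow> 'a" where
  "mv_one M = mv_neg M (mv_zero M)"

definition mv_times :: "('a, 'm) mv_scheme \<Rightarrow> 'a \<Rightarrow> 'a \<Rightarrow> 'a" where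
  "mv_times M x y = mv_neg M (mv_plus M (mv_neg M x) (mv_neg M y))"

definition mv_le :: "('a, 'm) mv_scheme \<Rightarrow> 'a \<Rightarrow> 'a \<Rightarrow> bool" where
  "mv_le M x y \<longleftrightarrow> mv_plus M (mv_neg M x) y = mv_one M"

primrec mv_multiple :: "('a, 'm) mv_scheme \<Rightarrow> nat \<Rightarrow> 'a \<Rightarrow> 'a" where
  "mv_multiple M 0 y = mv_zero M"
| "mv_multiple M (Suc n) y = mv_plus M (mv_multiple M n y) y"

locale mv_algebra =
  fixes M :: "('a, 'm) mv_scheme" (structure)
  assumes plus_closed: "\<lbrakk>x \<in> carrier M; y \<in> carrier M\<rbrakk> \<Longrightarrow> mv_plus M x y \<in> carrier M"
    and neg_closed: "x \<in> carrier M \<Longrightarrow> mv_neg M x \<in> carrier M"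
    and zero_closed: "mv_zero M \<in> carrier M"
    and plus_assoc: "\<lbrakk>x \<in> carrier M; y \<in> carrier M; z \<in> carrier M\<rbrakk>
          \<Longrightarrow> mv_plus M (mv_plus M x y) z = mv_plus M x (mv_plus M y z)"
    and plus_comm: "\<lbrakk>x \<in> carrier M; y \<in> carrier M\<rbrakk> \<Longrightarrow> mv_plus M x y = mv_plus M y x"
    and plus_zero: "x \<in> carrier M \<Longrightarrow> mv_plus M x (mv_zero M) = x"
    and neg_neg: "x \<in> carrier M \<Longrightarrow> mv_neg M (mv_neg M x) = x"
    and plus_one: "x \<in> carrier M \<Longrightarrow> mv_plus M x (mv_one M) = mv_one M"
    and lukasiewicz: "\<lbrakk>x \<in> carrier M; y \<in> carrier M\<rbrakk>
          \<Longrightarrow> mv_plus M (mv_neg M (mv_plus M (mv_neg M x) y)) y =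
              mv_plus M (mv_neg M (mv_plus M (mv_neg M y) x)) x"

definition mv_hom :: "('a, 'm) mv_scheme \<Rightarrow> ('b, 'n) mv_scheme \<Rightarrow> ('a \<Rightarrow> 'b) set" where
  "mv_hom M N = {h. h \<in> carrier M \<rightarrow> carrier N \<and>
     (\<forall>x\<in>carrier M. \<forall>y\<in>carrier M. h (mv_plus M x y) = mv_plus N (h x) (h y)) \<and>
     (\<forall>x\<in>carrier M. h (mv_neg M x) = mv_neg N (h x)) \<and>
     h (mv_zero M) = mv_zero N}"

definition mv_embeddable :: "('a, 'm) mv_scheme \<Rightarrow> ('b, 'n) mv_scheme \<Rightarrow> bool" where
  "mv_embeddable M N \<longleftrightarrow> (\<exists>h\<in>mv_hom M N. inj_on h (carrier M))"

definition mv_divisible :: "('a, 'm) mv_scheme \<Rightarrow> bool" where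
  "mv_divisible M \<longleftrightarrow> (\<forall>x\<in>carrier M. \<forall>n\<ge>1. \<exists>y\<in>carrier M.
     mv_multiple M n y = x \<and> mv_times M (mv_multiple M (n - 1) y) y = mv_zero M)"

definition mv_square_root :: "('a, 'm) mv_scheme \<Rightarrow> ('a \<Rightarrow> 'a) \<Rightarrow> bool" where
  "mv_square_root M s \<longleftrightarrow> s \<in> carrier M \<rightarrow> carrier M \<and>
     (\<forall>x\<in>carrier M. mv_times M (s x) (s x) = x) \<and>
     (\<forall>x\<in>carrier M. \<forall>y\<in>carrier M. mv_le M (mv_times M y y) x \<longrightarrow> mv_le M y (s x))"

definition mv_strict :: "('a, 'm) mv_scheme \<Rightarrow> bool" where
  "mv_strict M \<longleftrightarrow>
     (\<exists>s. mv_square_root M s \<and> s (mv_zero M) = mv_neg M (s (mv_zero M)))"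

definition dyadic_mv :: "real mv" where
  "dyadic_mv = \<lparr>carrier = {real i / 2 ^ n | i n. n \<ge> 1 \<and> i \<le> 2 ^ n},
     mv_plus = (\<lambda>x y. min (x + y) 1), mv_neg = (\<lambda>x. 1 - x), mv_zero = 0\<rparr>"

lemma mv_algebra_dyadic: "mv_algebra dyadic_mv"
proof -
  let ?D = "{real i / 2 ^ n | i n. n \<ge> (1::nat) \<and> i \<le> 2 ^ n}"
  have unit: "0 \<le> x \<and> x \<le> 1" if "x \<in> ?D" for x
  proof -
    from that obtain i n :: nat where x: "x = real i / 2 ^ n" and i: "i \<le> 2 ^ n" by blast
    have "real i \<le> 2 ^ n" using i of_nat_mono[OF i, where 'a = real] by simp
    then show ?thesis unfolding x by simp
  qed
  have memI: "x \<in> ?D" if "0 \<le> x" "x \<le> 1" "n \<ge> 1" "x = real_of_int k / 2 ^ n" for x n k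
  proof -
    have "0 \<le> k" using that(1) unfolding that(4) by (simp add: zero_le_divide_iff not_le[of "2 ^ n" 0, THEN iffD2])
    moreover have "real_of_int k \<le> 2 ^ n" using that by simp
    then have "k \<le> 2 ^ n" by (metis of_int_le_iff of_int_numeral of_int_power)
    then have "nat k \<le> 2 ^ n" by (simp add: nat_le_iff)
    moreover have "x = real (nat k) / 2 ^ n" using \<open>0 \<le> k\<close> that(4) by simp
    ultimately show ?thesis using that(3) by blast
  qed
  have neg: "1 - x \<in> ?D" if "x \<in> ?D" for x
  proof -
    from that obtain i n :: nat where x: "x = real i / 2 ^ n" and n: "n \<ge> 1" by blast
    have "1 - x = real_of_int (2 ^ n - int i) / 2 ^ n" unfolding x by (simp add: field_simps)
    then show ?thesis using unit[OF that] by (intro memI[OF _ _ n, of _ "2 ^ n - int i"]) simp_all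
  qed
  have zero: "0 \<in> ?D" by (rule memI[of 0 1 0]) auto
  have plus: "min (x + y) 1 \<in> ?D" if "x \<in> ?D" "y \<in> ?D" for x y
  proof (cases "x + y \<le> 1")
    case False
    then show ?thesis using neg[OF zero] by (simp add: min_def)
  next
    case True
    from that obtain i n j m :: nat where x: "x = real i / 2 ^ n" and n: "n \<ge> 1"
      and y: "y = real j / 2 ^ m" by blast
    have "x + y = real_of_int (int i * 2 ^ m + int j * 2 ^ n) / 2 ^ (n + m)"
      unfolding x y by (simp add: field_simps power_add)
    moreover have "n + m \<ge> 1" using n by simp
    moreover have "0 \<le> x + y" using unit[OF that(1)] unit[OF that(2)] by simp
    ultimately have "x + y \<in> ?D" using memI True by blast
    then show ?thesis using True by (simp add: min_def)
  qed
  show ?thesis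
  proof (unfold_locales, goal_cases)
    case (1 x y) then show ?case using plus by (simp add: dyadic_mv_def)
  next
    case (2 x) then show ?case using neg by (simp add: dyadic_mv_def)
  next
    case 3 then show ?case using zero by (simp add: dyadic_mv_def)
  next
    case (4 x y z) then show ?case
      using unit[of x] unit[of y] unit[of z] by (simp add: dyadic_mv_def min_def)
  next
    case (6 x) then show ?case using unit[of x] by (simp add: dyadic_mv_def)
  next
    case (8 x) then show ?case using unit[of x] by (simp add: dyadic_mv_def mv_one_def)
  next
    case (9 x y) then show ?case
      using unit[of x] unit[of y] by (simp add: dyadic_mv_def min_def)
  qed (simp_all add: dyadic_mv_def add.commute)
qed


section \<open>Tribes\<close>

text \<open>Fuzzy sets on \<open>\<Omega>\<close> are extensional functions, so that functions agreeing on
  \<open>\<Omega>\<close> are equal.  The series is summed in \<^typ>\<open>ennreal\<close>, where it always converges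
  (possibly to \<open>\<infinity>\<close>).\<close>

definition tribe_sum :: "'a set \<Rightarrow> (nat \<Rightarrow> 'a \<Rightarrow> real) \<Rightarrow> 'a \<Rightarrow> real" where
  "tribe_sum \<Omega> f = (\<lambda>\<omega>\<in>\<Omega>. enn2real (min (\<Sum>n. ennreal (f n \<omega>)) 1))"

locale tribe =
  fixes \<Omega> :: "'a set" and \<F> :: "('a \<Rightarrow> real) set"
  assumes nonempty: "\<Omega> \<noteq> {}"
    and fuzzy: "\<F> \<subseteq> \<Omega> \<rightarrow>\<^sub>E {0..1}"
    and zero: "(\<lambda>\<omega>\<in>\<Omega>. 0) \<in> \<F>"
    and compl: "\<And>f. f \<in> \<F> \<Longrightarrow> (\<lambda>\<omega>\<in>\<Omega>. 1 - f \<omega>) \<in> \<F>"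
    and sum: "\<And>f. (\<And>n. f n \<in> \<F>) \<Longrightarrow> tribe_sum \<Omega> f \<in> \<F>"

definition tribe_mv :: "'a set \<Rightarrow> ('a \<Rightarrow> real) set \<Rightarrow> ('a \<Rightarrow> real) mv" where
  "tribe_mv \<Omega> \<F> = \<lparr>carrier = \<F>,
     mv_plus = (\<lambda>f g. \<lambda>\<omega>\<in>\<Omega>. min (f \<omega> + g \<omega>) 1),
     mv_neg = (\<lambda>f. \<lambda>\<omega>\<in>\<Omega>. 1 - f \<omega>),
     mv_zero = (\<lambda>\<omega>\<in>\<Omega>. 0)\<rparr>"

definition tribe_sets :: "'a set \<Rightarrow> ('a \<Rightarrow> real) set \<Rightarrow> 'a set set" where
  "tribe_sets \<Omega> \<F> = {A. A \<subseteq> \<Omega> \<and> (\<lambda>\<omega>\<in>\<Omega>. indicator A \<omega>) \<in> \<F>}"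

context tribe
begin

lemma plus_mem:
  assumes "f \<in> \<F>" "g \<in> \<F>"
  shows "(\<lambda>\<omega>\<in>\<Omega>. min (f \<omega> + g \<omega>) 1) \<in> \<F>"
proof -
  define h where "h n = (if n = 0 then f else if n = 1 then g else (\<lambda>\<omega>\<in>\<Omega>. 0))" for n :: nat
  have "tribe_sum \<Omega> h \<in> \<F>" using assms zero by (intro sum) (auto simp: h_def)
  moreover have "tribe_sum \<Omega> h = (\<lambda>\<omega>\<in>\<Omega>. min (f \<omega> + g \<omega>) 1)"
    unfolding tribe_sum_def
  proof (rule restrict_ext)
    fix \<omega> assume w: "\<omega> \<in> \<Omega>"
    then have nn: "0 \<le> f \<omega>" "0 \<le> g \<omega>" using assms fuzzy by (auto simp: PiE_iff subset_iff)
    have "(\<Sum>n. ennreal (h n \<omega>)) = (\<Sum>n\<in>{0,1}. ennreal (h n \<omega>))"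
      using w by (intro suminf_finite) (auto simp: h_def)
    also have "\<dots> = ennreal (f \<omega> + g \<omega>)" using nn by (simp add: h_def)
    finally have *: "min (\<Sum>n. ennreal (h n \<omega>)) 1 = ennreal (min (f \<omega> + g \<omega>) 1)"
      using ennreal_le_1[of "f \<omega> + g \<omega>"] by (simp add: min_def del: ennreal_plus)
    show "enn2real (min (\<Sum>n. ennreal (h n \<omega>)) 1) = min (f \<omega> + g \<omega>) 1"
      unfolding * using nn by (subst enn2real_ennreal) auto
  qed
  ultimately show ?thesis by simp
qed

lemma mv_algebra_tribe: "mv_algebra (tribe_mv \<Omega> \<F>)"
proof -
  have val: "0 \<le> f \<omega>" "f \<omega> \<le> 1" if "f \<in> \<F>" "\<omega> \<in> \<Omega>" for f \<omega>
    using that fuzzy by (auto simp: PiE_iff subset_iff)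
  have ext: "f \<omega> = undefined" if "f \<in> \<F>" "\<omega> \<notin> \<Omega>" for f \<omega>
    using that fuzzy by (auto simp: PiE_iff extensional_def subset_iff)
  show ?thesis
  proof (unfold_locales, goal_cases)
    case (1 x y) then show ?case using plus_mem by (simp add: tribe_mv_def)
  next
    case (2 x) then show ?case using compl by (simp add: tribe_mv_def)
  next
    case 3 then show ?case using zero by (simp add: tribe_mv_def)
  qed (auto simp: tribe_mv_def mv_one_def min_def fun_eq_iff restrict_def ext dest: val
         intro: antisym val)
qed

lemma mv_le_tribe:
  shows "mv_le (tribe_mv \<Omega> \<F>) f g \<longleftrightarrow> (\<forall>\<omega>\<in>\<Omega>. f \<omega> \<le> g \<omega>)"
proof -
  have "min (1 - a + b) 1 = 1 \<longleftrightarrow> a \<le> b" for a b :: real by (auto simp: min_def)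
  then show ?thesis by (auto simp: mv_le_def mv_one_def tribe_mv_def fun_eq_iff restrict_def)
qed

lemma sigma_algebra_tribe_sets: "sigma_algebra \<Omega> (tribe_sets \<Omega> \<F>)"
  unfolding sigma_algebra_iff2
proof (intro conjI ballI allI impI)
  show "tribe_sets \<Omega> \<F> \<subseteq> Pow \<Omega>" by (auto simp: tribe_sets_def)
  show "{} \<in> tribe_sets \<Omega> \<F>" using zero by (simp add: tribe_sets_def indicator_def)
next
  fix A assume A: "A \<in> tribe_sets \<Omega> \<F>"
  then have "(\<lambda>\<omega>\<in>\<Omega>. indicator A \<omega>) \<in> \<F>" by (simp add: tribe_sets_def)
  then have "(\<lambda>\<omega>\<in>\<Omega>. 1 - (\<lambda>\<omega>\<in>\<Omega>. indicator A \<omega>) \<omega>) \<in> \<F>" by (rule compl)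
  moreover have "(\<lambda>\<omega>\<in>\<Omega>. 1 - (\<lambda>\<omega>\<in>\<Omega>. indicator A \<omega> :: real) \<omega>) = (\<lambda>\<omega>\<in>\<Omega>. indicator (\<Omega> - A) \<omega>)"
    by (rule restrict_ext) (auto simp: indicator_def)
  ultimately have "(\<lambda>\<omega>\<in>\<Omega>. indicator (\<Omega> - A) \<omega>) \<in> \<F>" by (simp only:)
  then show "\<Omega> - A \<in> tribe_sets \<Omega> \<F>" by (simp add: tribe_sets_def)
next
  fix A :: "nat \<Rightarrow> 'a set" assume A: "range A \<subseteq> tribe_sets \<Omega> \<F>"
  let ?f = "\<lambda>n. \<lambda>\<omega>\<in>\<Omega>. indicator (A n) \<omega> :: real"
  have "tribe_sum \<Omega> ?f \<in> \<F>" using A by (intro sum) (auto simp: tribe_sets_def)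
  moreover have "tribe_sum \<Omega> ?f = (\<lambda>\<omega>\<in>\<Omega>. indicator (\<Union>n. A n) \<omega>)"
    unfolding tribe_sum_def
  proof (rule restrict_ext)
    fix \<omega> assume w: "\<omega> \<in> \<Omega>"
    show "enn2real (min (\<Sum>n. ennreal (?f n \<omega>)) 1) = indicator (\<Union>n. A n) \<omega>"
    proof (cases "\<omega> \<in> (\<Union>n. A n)")
      case False
      then show ?thesis using w by (simp add: indicator_def)
    next
      case True
      then obtain k where k: "\<omega> \<in> A k" by blast
      have "(1::ennreal) = (\<Sum>n\<in>{k}. ennreal (?f n \<omega>))" using k w by simp
      also have "\<dots> \<le> (\<Sum>n. ennreal (?f n \<omega>))" by (rule sum_le_suminf) auto
      finally have "min (\<Sum>n. ennreal (?f n \<omega>)) 1 = 1" by (simp add: min_absorb2)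
      then have "enn2real (min (\<Sum>n. ennreal (?f n \<omega>)) 1) = 1" by (metis enn2real_1)
      then show ?thesis using True by (simp add: indicator_def)
    qed
  qed
  ultimately have "(\<lambda>\<omega>\<in>\<Omega>. indicator (\<Union>n. A n) \<omega>) \<in> \<F>" by (simp only:)
  then show "(\<Union>n. A n) \<in> tribe_sets \<Omega> \<F>" using A by (auto simp: tribe_sets_def)
qed

lemma sets_sigma_tribe_sets: "sets (sigma \<Omega> (tribe_sets \<Omega> \<F>)) = tribe_sets \<Omega> \<F>"
  by (simp add: sigma_algebra.sets_measure_of_eq[OF sigma_algebra_tribe_sets])

end

end

(* Every statement is equivalent to \<F> containing the constants 2^-n. These constants suffice for
   (iv): binary expansion writes a measurable f as the series of 2^-(n+1) \<chi>_(A n), where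
   A n is the set of points whose n-th binary digit is 1, and each term is the \<odot>-product of a constant
   and an indicator. Conversely, once \<F> contains the constants, every f in \<F> is measurable, since
   \<chi>_{f > c} is the sum of infinitely many copies of max (f - c) 0; hence (iv) yields (i) and (v).
   Finally, (ii) and (v) both give the constants 2^-n by successive halving, as y \<oplus> y = c determines
   y = c / 2 when c < 1, and y = y' determines y = 1 / 2;
   (i) gives them because f / 2 = 1 - ((1 - f) + 1) / 2. *)
theory Submission imports Defs begin

section \<open>Binary expansion of a real in [0, 1]\<close>

fun binary_rem :: "real \<Rightarrow> nat \<Rightarrow> real" where
  "binary_rem x 0 = x"
| "binary_rem x (Suc n) =
     (if binary_rem x n \<ge> 1 / 2 then 2 * binary_rem x n - 1 else 2 * binary_rem x n)"

text \<open>The doubling map with branch point 1/2 sends [0, 1] into itself. The point 1 is fixed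
  with digit 1 at every stage, so the right endpoint is covered too.\<close>

lemma binary_rem_bounds:
  assumes "0 \<le> x" "x \<le> 1"
  shows "0 \<le> binary_rem x n \<and> binary_rem x n \<le> 1"
  using assms by (induction n) auto

text \<open>Each step splits off one digit: a remainder r with digit d and successor r' satisfies r
  = d / 2 + r' / 2. This is pure algebra and holds for every real \<open>x\<close>.\<close>

lemma binary_rem_expansion:
  "x = (\<Sum>k<n. if binary_rem x k \<ge> 1 / 2 then 1 / 2 ^ Suc k else 0) + binary_rem x n / 2 ^ n"
  by (induction n) (auto simp: field_simps)

text \<open>The error after n digits is the n-th remainder divided by 2^n, squeezed between 0 and
  (1/2)^n.\<close>

lemma binary_sums:
  assumes "0 \<le> x" "x \<le> 1"
  shows "(\<lambda>k. if binary_rem x k \<ge> 1 / 2 then 1 / 2 ^ Suc k else 0) sums x"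
proof -
  have "(\<lambda>n. binary_rem x n / 2 ^ n) \<longlonglongrightarrow> 0"
  proof (rule tendsto_sandwich[of "\<lambda>_. 0" _ _ "\<lambda>n. (1 / 2) ^ n"])
    show "(\<lambda>n. (1 / 2 :: real) ^ n) \<longlonglongrightarrow> 0" by (rule LIMSEQ_power_zero) simp
  qed (use binary_rem_bounds[OF assms] in \<open>auto simp: field_simps power_divide\<close>)
  then have "(\<lambda>n. x - binary_rem x n / 2 ^ n) \<longlonglongrightarrow> x - 0" by (intro tendsto_intros)
  moreover have "x - binary_rem x n / 2 ^ n =
      (\<Sum>k<n. if binary_rem x k \<ge> 1 / 2 then 1 / 2 ^ Suc k else 0)" for n
    using binary_rem_expansion[of x n] by linarith
  ultimately show ?thesis by (simp add: sums_def)
qed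

text \<open>Ensures that the digit sets of a measurable function are measurable.\<close>

lemma borel_measurable_binary_rem [measurable]: "(\<lambda>x. binary_rem x n) \<in> borel_measurable borel"
  by (induction n) auto

section \<open>Pointwise operations in a tribe\<close>

context tribe
begin

lemma value_bounds:
  assumes "f \<in> \<F>" "\<omega> \<in> \<Omega>"
  shows "0 \<le> f \<omega>" "f \<omega> \<le> 1"
  using assms fuzzy by (auto simp: PiE_iff subset_iff)

lemma restrict_mem: "f \<in> \<F> \<Longrightarrow> restrict f \<Omega> = f"
  using fuzzy by (auto simp: PiE_iff subset_iff extensional_restrict)

text \<open>Members of \<open>\<F>\<close> are extensional, so agreement on \<Omega> is enough for
  equality.\<close>

lemma mem_eqI:
  assumes "f \<in> \<F>" "\<And>\<omega>. \<omega> \<in> \<Omega> \<Longrightarrow> g \<omega> = f \<omega>"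
  shows "(\<lambda>\<omega>\<in>\<Omega>. g \<omega>) = f"
  using assms restrict_mem[OF assms(1)] by (metis restrict_ext)

text \<open>The terms are nonnegative, so the \<open>ennreal\<close> series has the real sum, and
  the bound \<open>f \<omega> \<le> 1\<close> makes the truncation in \<open>tribe_sum\<close>
  inactive.\<close>

lemma sums_mem:
  assumes g: "\<And>n. (\<lambda>\<omega>\<in>\<Omega>. g n \<omega>) \<in> \<F>"
    and f: "\<And>\<omega>. \<omega> \<in> \<Omega> \<Longrightarrow> (\<lambda>n. g n \<omega>) sums f \<omega> \<and> f \<omega> \<le> 1"
  shows "(\<lambda>\<omega>\<in>\<Omega>. f \<omega>) \<in> \<F>"
proof -
  have "tribe_sum \<Omega> (\<lambda>n. \<lambda>\<omega>\<in>\<Omega>. g n \<omega>) = (\<lambda>\<omega>\<in>\<Omega>. f \<omega>)"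
    unfolding tribe_sum_def
  proof (rule restrict_ext)
    fix \<omega> assume w: "\<omega> \<in> \<Omega>"
    have nn: "0 \<le> g n \<omega>" for n using value_bounds(1)[OF g w] w by simp
    have S: "(\<lambda>n. g n \<omega>) sums f \<omega>" and le: "f \<omega> \<le> 1" using f w by auto
    have "0 \<le> f \<omega>" using sums_le[OF _ sums_zero S] nn by simp
    moreover have "(\<Sum>n. ennreal (g n \<omega>)) = ennreal (f \<omega>)"
      using nn S by (rule suminf_ennreal_eq)
    ultimately show "enn2real (min (\<Sum>n. ennreal ((\<lambda>\<omega>\<in>\<Omega>. g n \<omega>) \<omega>)) 1) = f \<omega>"
      using w le ennreal_le_1[of "f \<omega>"] by (simp add: min_absorb1)
  qed
  then show ?thesis using sum[of "\<lambda>n. \<lambda>\<omega>\<in>\<Omega>. g n \<omega>"] g by simp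
qed

text \<open>This is the Lukasiewicz product, obtained from \<oplus> by De Morgan.\<close>

lemma times_mem:
  assumes "f \<in> \<F>" "g \<in> \<F>"
  shows "(\<lambda>\<omega>\<in>\<Omega>. max (f \<omega> + g \<omega> - 1) 0) \<in> \<F>"
proof -
  have "(\<lambda>\<omega>\<in>\<Omega>. 1 - (\<lambda>\<omega>\<in>\<Omega>. min ((\<lambda>\<omega>\<in>\<Omega>. 1 - f \<omega>) \<omega> + (\<lambda>\<omega>\<in>\<Omega>. 1 - g \<omega>) \<omega>) 1) \<omega>) \<in> \<F>"
    using assms by (intro compl plus_mem)
  also have "(\<lambda>\<omega>\<in>\<Omega>. 1 - (\<lambda>\<omega>\<in>\<Omega>. min ((\<lambda>\<omega>\<in>\<Omega>. 1 - f \<omega>) \<omega> + (\<lambda>\<omega>\<in>\<Omega>. 1 - g \<omega>) \<omega>) 1) \<omega>)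
      = (\<lambda>\<omega>\<in>\<Omega>. max (f \<omega> + g \<omega> - 1) 0)"
    by (rule restrict_ext) (auto simp: max_def min_def)
  finally show ?thesis .
qed

lemma tribe_mv_simps:
  "carrier (tribe_mv \<Omega> \<F>) = \<F>"
  "mv_plus (tribe_mv \<Omega> \<F>) f g = (\<lambda>\<omega>\<in>\<Omega>. min (f \<omega> + g \<omega>) 1)"
  "mv_neg (tribe_mv \<Omega> \<F>) f = (\<lambda>\<omega>\<in>\<Omega>. 1 - f \<omega>)"
  "mv_zero (tribe_mv \<Omega> \<F>) = (\<lambda>\<omega>\<in>\<Omega>. 0)"
  by (simp_all add: tribe_mv_def)

lemma mv_times_tribe:
  "mv_times (tribe_mv \<Omega> \<F>) f g = (\<lambda>\<omega>\<in>\<Omega>. max (f \<omega> + g \<omega> - 1) 0)"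
  unfolding mv_times_def tribe_mv_simps
  by (rule restrict_ext) (auto simp: max_def min_def)

text \<open>For nonnegative values, truncating after every addition gives the same result as
  truncating once at the end.\<close>

lemma mv_multiple_tribe:
  assumes "f \<in> \<F>"
  shows "mv_multiple (tribe_mv \<Omega> \<F>) n f = (\<lambda>\<omega>\<in>\<Omega>. min (real n * f \<omega>) 1)"
proof (induction n)
  case (Suc n)
  show ?case unfolding mv_multiple.simps Suc tribe_mv_simps
  proof (rule restrict_ext)
    fix \<omega> assume w: "\<omega> \<in> \<Omega>"
    have "0 \<le> f \<omega>" using assms w by (rule value_bounds)
    then show "min ((\<lambda>\<omega>\<in>\<Omega>. min (real n * f \<omega>) 1) \<omega> + f \<omega>) 1 = min (real (Suc n) * f \<omega>) 1"
      using w by (simp add: min_def distrib_right)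
  qed
qed (simp add: tribe_mv_simps)

section \<open>The pivot condition: the constants 2^-n, and their link with measurability\<close>

definition dyadic_consts :: bool where
  "dyadic_consts \<longleftrightarrow> (\<forall>n. (\<lambda>\<omega>\<in>\<Omega>. 1 / 2 ^ n) \<in> \<F>)"

lemma one_mem: "(\<lambda>\<omega>\<in>\<Omega>. 1) \<in> \<F>"
  using compl[OF zero] by (simp cong: restrict_cong)

text \<open>Induction from the constant 1, which lies in every tribe; each use only has to supply a
  halving step.\<close>

lemma dyadic_constsI:
  assumes "\<And>n. (\<lambda>\<omega>\<in>\<Omega>. 1 / 2 ^ n) \<in> \<F> \<Longrightarrow> (\<lambda>\<omega>\<in>\<Omega>. 1 / 2 ^ Suc n) \<in> \<F>"
  shows dyadic_consts
  unfolding dyadic_consts_def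
proof
  fix n show "(\<lambda>\<omega>\<in>\<Omega>. 1 / 2 ^ n) \<in> \<F>"
  proof (induction n)
    case 0
    show ?case using one_mem by (simp only: power_0 div_by_1)
  qed (rule assms)
qed

lemma measurable_mem:
  assumes dyadic_consts and meas: "f \<in> borel_measurable (sigma \<Omega> (tribe_sets \<Omega> \<F>))"
    and f: "f \<in> \<Omega> \<rightarrow>\<^sub>E {0..1}"
  shows "f \<in> \<F>"
proof -
  let ?S = "tribe_sets \<Omega> \<F>"
  have space: "space (sigma \<Omega> ?S) = \<Omega>"
    by (simp add: space_measure_of_conv)
  define A where "A n = {\<omega> \<in> \<Omega>. binary_rem (f \<omega>) n \<ge> 1 / 2}" for n
  have "{\<omega> \<in> space (sigma \<Omega> ?S). binary_rem (f \<omega>) n \<ge> 1 / 2} \<in> sets (sigma \<Omega> ?S)" for n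
    using meas by measurable
  then have "A n \<in> ?S" for n by (simp only: A_def space sets_sigma_tribe_sets)
  then have A: "(\<lambda>\<omega>\<in>\<Omega>. indicator (A n) \<omega>) \<in> \<F>" for n by (simp add: tribe_sets_def)
  have terms: "(\<lambda>\<omega>\<in>\<Omega>. if binary_rem (f \<omega>) n \<ge> 1 / 2 then 1 / 2 ^ Suc n else 0) \<in> \<F>" for n
  proof -
    have c: "(\<lambda>\<omega>\<in>\<Omega>. 1 / 2 ^ Suc n) \<in> \<F>" using assms(1) unfolding dyadic_consts_def by blast
    \<comment> \<open>The product of the constant c = 2^-(n+1) with an indicator is a
      \<odot>-product: \<chi> + c - 1 equals c on \<open>A n\<close> and c - 1 elsewhere. The two
      bounds on c make the truncation at 0 return c and 0 respectively.\<close>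
    have "(1::real) / 2 ^ Suc n \<le> 1"
      using one_le_power[of "2 :: real" "Suc n"] by (simp add: field_simps)
    moreover have "(0::real) < 1 / 2 ^ Suc n" by simp
    ultimately have "(\<lambda>\<omega>\<in>\<Omega>. if binary_rem (f \<omega>) n \<ge> 1 / 2 then 1 / 2 ^ Suc n else (0::real)) =
        (\<lambda>\<omega>\<in>\<Omega>. max ((\<lambda>\<omega>\<in>\<Omega>. indicator (A n) \<omega>) \<omega> + (\<lambda>\<omega>\<in>\<Omega>. 1 / 2 ^ Suc n) \<omega> - 1) 0)"
      by (intro restrict_ext) (simp add: A_def indicator_def del: power_Suc)
    then show ?thesis using times_mem[OF A c] by simp
  qed
  have "(\<lambda>\<omega>\<in>\<Omega>. f \<omega>) \<in> \<F>"
  proof (rule sums_mem[OF terms])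
    fix \<omega> assume "\<omega> \<in> \<Omega>"
    then have "0 \<le> f \<omega>" "f \<omega> \<le> 1" using f by (auto simp: PiE_iff)
    then show "(\<lambda>n. if binary_rem (f \<omega>) n \<ge> 1 / 2 then 1 / 2 ^ Suc n else 0) sums f \<omega> \<and> f \<omega> \<le> 1"
      using binary_sums by blast
  qed
  moreover have "(\<lambda>\<omega>\<in>\<Omega>. f \<omega>) = f" using f by (simp add: PiE_iff extensional_restrict)
  ultimately show ?thesis by simp
qed

text \<open>A constant is measurable for any \<sigma>-algebra, so its binary expansion already lies
  within reach of \<open>measurable_mem\<close>.\<close>

lemma const_mem:
  assumes dyadic_consts "0 \<le> c" "c \<le> 1"
  shows "(\<lambda>\<omega>\<in>\<Omega>. c) \<in> \<F>"
proof (rule measurable_mem[OF assms(1)])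
  have "(\<lambda>\<omega>. c) \<in> borel_measurable (sigma \<Omega> (tribe_sets \<Omega> \<F>))" by simp
  then show "(\<lambda>\<omega>\<in>\<Omega>. c) \<in> borel_measurable (sigma \<Omega> (tribe_sets \<Omega> \<F>))"
    by (rule measurable_cong[THEN iffD1, rotated]) (simp add: space_measure_of_conv)
qed (use assms in auto)

lemma sets_greater:
  assumes dyadic_consts and f: "f \<in> \<F>" and c: "0 \<le> c" "c \<le> 1"
  shows "{\<omega> \<in> \<Omega>. c < f \<omega>} \<in> tribe_sets \<Omega> \<F>"
proof -
  define g where "g = (\<lambda>\<omega>\<in>\<Omega>. max (f \<omega> - c) 0)"
  \<comment> \<open>\<open>g\<close> is the \<odot>-product of \<open>f\<close> and the constant 1 -
    c, which lies in [0, 1] by the bounds on \<open>c\<close>.\<close>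
  have g: "g \<in> \<F>"
    using times_mem[OF f const_mem[OF assms(1), of "1 - c"]] c
    by (simp add: g_def cong: restrict_cong)
  have "tribe_sum \<Omega> (\<lambda>_. g) = (\<lambda>\<omega>\<in>\<Omega>. indicator {\<omega> \<in> \<Omega>. c < f \<omega>} \<omega>)"
    unfolding tribe_sum_def
  proof (rule restrict_ext)
    fix \<omega> assume w: "\<omega> \<in> \<Omega>"
    show "enn2real (min (\<Sum>n. ennreal (g \<omega>)) 1) = indicator {\<omega> \<in> \<Omega>. c < f \<omega>} \<omega>"
    proof (cases "c < f \<omega>")
      case True
      then have pos: "0 < g \<omega>" using w by (simp add: g_def)
      \<comment> \<open>Where \<open>g\<close> is positive, finitely many copies already exceed 1,
        so the truncated series equals 1 there.\<close>
      obtain N :: nat where N: "1 < real N * g \<omega>" using reals_Archimedean3[OF pos] by blast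
      have "(1::ennreal) \<le> ennreal (real N * g \<omega>)" using N by (simp add: ennreal_ge_1)
      also have "\<dots> = (\<Sum>n<N. ennreal (g \<omega>))"
        using pos by (simp add: ennreal_mult ennreal_of_nat_eq_real_of_nat)
      also have "\<dots> \<le> (\<Sum>n. ennreal (g \<omega>))" by (rule sum_le_suminf) auto
      finally show ?thesis using True w by (simp add: min_absorb2)
    qed (use w in \<open>simp add: g_def\<close>)
  qed
  then have "(\<lambda>\<omega>\<in>\<Omega>. indicator {\<omega> \<in> \<Omega>. c < f \<omega>} \<omega>) \<in> \<F>" using sum[of "\<lambda>_. g"] g by simp
  then show ?thesis by (auto simp: tribe_sets_def)
qed

text \<open>Only thresholds in [0, 1] need \<open>sets_greater\<close>: as \<open>f\<close> takes
  values in [0, 1], the other superlevel sets are \<Omega> or empty.\<close>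

lemma mem_measurable:
  assumes dyadic_consts and f: "f \<in> \<F>"
  shows "f \<in> borel_measurable (sigma \<Omega> (tribe_sets \<Omega> \<F>))"
  unfolding borel_measurable_iff_greater
proof
  fix a :: real
  interpret sigma_algebra \<Omega> "tribe_sets \<Omega> \<F>" by (rule sigma_algebra_tribe_sets)
  have "{\<omega> \<in> \<Omega>. a < f \<omega>} \<in> tribe_sets \<Omega> \<F>"
  proof -
    consider "a < 0" | "0 \<le> a" "a \<le> 1" | "1 < a" by linarith
    then show ?thesis
    proof cases
      case 1
      then have "{\<omega> \<in> \<Omega>. a < f \<omega>} = \<Omega>" using value_bounds[OF f] by force
      then show ?thesis using top by (simp only:)
    next
      case 3
      then have "{\<omega> \<in> \<Omega>. a < f \<omega>} = {}" using value_bounds[OF f] by force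
      then show ?thesis by (simp only: empty_sets)
    qed (rule sets_greater[OF assms])
  qed
  then show "{\<omega> \<in> space (sigma \<Omega> (tribe_sets \<Omega> \<F>)). a < f \<omega>}
      \<in> sets (sigma \<Omega> (tribe_sets \<Omega> \<F>))"
    by (simp add: space_measure_of_conv sets_sigma_tribe_sets)
qed

text \<open>The passage to measurable functions and back closes \<open>\<F>\<close> under Borel maps
  preserving [0, 1]. It serves for (x + 1) / 2 and for x / n.\<close>

lemma borel_image_mem:
  assumes dyadic_consts "f \<in> \<F>" "h \<in> borel_measurable borel"
    and "\<And>x. 0 \<le> x \<Longrightarrow> x \<le> 1 \<Longrightarrow> 0 \<le> h x \<and> h x \<le> 1"
  shows "(\<lambda>\<omega>\<in>\<Omega>. h (f \<omega>)) \<in> \<F>"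
proof (rule measurable_mem[OF assms(1)])
  have "(\<lambda>\<omega>. h (f \<omega>)) \<in> borel_measurable (sigma \<Omega> (tribe_sets \<Omega> \<F>))"
    using mem_measurable[OF assms(1,2)] assms(3) by measurable
  then show "(\<lambda>\<omega>\<in>\<Omega>. h (f \<omega>)) \<in> borel_measurable (sigma \<Omega> (tribe_sets \<Omega> \<F>))"
    by (rule measurable_cong[THEN iffD1, rotated]) (simp add: space_measure_of_conv)
qed (use assms(4) value_bounds[OF assms(2)] in auto)

section \<open>Equivalence of the pivot condition with each of the five statements\<close>

lemma dyadic_consts_iff_measurable:
  "dyadic_consts \<longleftrightarrow> (\<forall>f \<in> \<Omega> \<rightarrow>\<^sub>E {0..1}.
     f \<in> borel_measurable (sigma \<Omega> (tribe_sets \<Omega> \<F>)) \<longrightarrow> f \<in> \<F>)" (is "_ \<longleftrightarrow> ?R")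
proof
  assume R: ?R
  show dyadic_consts unfolding dyadic_consts_def
  proof
    fix n :: nat
    have "(\<lambda>\<omega>. 1 / 2 ^ n :: real) \<in> borel_measurable (sigma \<Omega> (tribe_sets \<Omega> \<F>))" by simp
    then have "(\<lambda>\<omega>\<in>\<Omega>. 1 / 2 ^ n :: real) \<in> borel_measurable (sigma \<Omega> (tribe_sets \<Omega> \<F>))"
      by (rule measurable_cong[THEN iffD1, rotated]) (simp add: space_measure_of_conv)
    then show "(\<lambda>\<omega>\<in>\<Omega>. 1 / 2 ^ n) \<in> \<F>" using R by (auto simp: field_simps)
  qed
qed (use measurable_mem in blast)

lemma dyadic_consts_iff_const:
  "dyadic_consts \<longleftrightarrow> (\<forall>c\<in>{0..1}. (\<lambda>\<omega>\<in>\<Omega>. c) \<in> \<F>)"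
  using const_mem by (auto simp: dyadic_consts_def)

lemma dyadic_consts_iff_sqrt:
  "dyadic_consts \<longleftrightarrow> (\<forall>f\<in>\<F>. (\<lambda>\<omega>\<in>\<Omega>. (f \<omega> + 1) / 2) \<in> \<F>)" (is "_ \<longleftrightarrow> ?R")
proof
  assume dyadic_consts
  then show ?R using borel_image_mem[of _ "\<lambda>x. (x + 1) / 2"] by auto
next
  assume R: ?R
  show dyadic_consts
  proof (rule dyadic_constsI)
    fix n :: nat
    let ?c = "\<lambda>\<omega>\<in>\<Omega>. 1 / 2 ^ n :: real"
    assume "?c \<in> \<F>"
    \<comment> \<open>Conjugating the map c \<mapsto> (c + 1) / 2 by complementation gives c
      \<mapsto> c / 2.\<close>
    then have "(\<lambda>\<omega>\<in>\<Omega>. 1 - (\<lambda>\<omega>\<in>\<Omega>. ((\<lambda>\<omega>\<in>\<Omega>. 1 - ?c \<omega>) \<omega> + 1) / 2) \<omega>) \<in> \<F>"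
      using R compl by blast
    then show "(\<lambda>\<omega>\<in>\<Omega>. 1 / 2 ^ Suc n) \<in> \<F>" by (simp add: field_simps cong: restrict_cong)
  qed
qed

lemma dyadic_consts_iff_divisible: "dyadic_consts \<longleftrightarrow> mv_divisible (tribe_mv \<Omega> \<F>)"
proof
  assume D: dyadic_consts
  show "mv_divisible (tribe_mv \<Omega> \<F>)"
    unfolding mv_divisible_def tribe_mv_simps(1)
  proof (intro ballI allI impI)
    fix f and n :: nat
    assume f: "f \<in> \<F>" and n: "1 \<le> n"
    \<comment> \<open>The real quotient is the witness: its n-fold sum is \<open>f\<close>, which
      never exceeds 1, so no truncation occurs and the \<odot>-condition holds.\<close>
    define g where "g = (\<lambda>\<omega>\<in>\<Omega>. f \<omega> / real n)"
    have g: "g \<in> \<F>" unfolding g_def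
      using n by (intro borel_image_mem[OF D f, of "\<lambda>x. x / real n"]) (auto simp: field_simps)
    show "\<exists>y\<in>\<F>. mv_multiple (tribe_mv \<Omega> \<F>) n y = f \<and>
        mv_times (tribe_mv \<Omega> \<F>) (mv_multiple (tribe_mv \<Omega> \<F>) (n - 1) y) y = mv_zero (tribe_mv \<Omega> \<F>)"
    proof (intro bexI[OF _ g] conjI)
      show "mv_multiple (tribe_mv \<Omega> \<F>) n g = f"
        unfolding mv_multiple_tribe[OF g]
        by (rule mem_eqI[OF f]) (use n value_bounds[OF f] in \<open>auto simp: g_def\<close>)
      have "min (real (n - 1) * g \<omega>) 1 + g \<omega> - 1 \<le> 0" if w: "\<omega> \<in> \<Omega>" for \<omega>
      proof -
        have "real (n - 1) * g \<omega> + g \<omega> = f \<omega>"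
          using n w by (simp add: g_def of_nat_diff field_simps)
        then show ?thesis using value_bounds(2)[OF f w] by linarith
      qed
      then show "mv_times (tribe_mv \<Omega> \<F>) (mv_multiple (tribe_mv \<Omega> \<F>) (n - 1) g) g
          = mv_zero (tribe_mv \<Omega> \<F>)"
        unfolding mv_times_tribe mv_multiple_tribe[OF g] tribe_mv_simps
        by (intro restrict_ext) (simp add: max_absorb2)
    qed
  qed
next
  assume D: "mv_divisible (tribe_mv \<Omega> \<F>)"
  show dyadic_consts
  proof (rule dyadic_constsI)
    fix n :: nat
    let ?c = "\<lambda>\<omega>\<in>\<Omega>. 1 / 2 ^ n :: real"
    assume "?c \<in> \<F>"
    then obtain y where y: "y \<in> \<F>" "mv_multiple (tribe_mv \<Omega> \<F>) 2 y = ?c"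
      "mv_times (tribe_mv \<Omega> \<F>) (mv_multiple (tribe_mv \<Omega> \<F>) (2 - 1) y) y = mv_zero (tribe_mv \<Omega> \<F>)"
      using D[unfolded mv_divisible_def tribe_mv_simps(1), rule_format, of ?c 2] by auto
    have "1 / 2 ^ Suc n = y \<omega>" if w: "\<omega> \<in> \<Omega>" for \<omega>
    proof -
      have "min (2 * y \<omega>) 1 = 1 / 2 ^ n"
        using fun_cong[OF y(2), of \<omega>] w by (simp add: mv_multiple_tribe[OF y(1)])
      \<comment> \<open>For n = 0 the doubling equation only yields y \<ge> 1/2; the
        \<odot>-condition supplies y \<le> 1/2, so the truncation is inactive in all cases.\<close>
      moreover have "max (min (y \<omega>) 1 + y \<omega> - 1) 0 = 0"
        using fun_cong[OF y(3), of \<omega>] w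
        by (simp add: mv_multiple_tribe[OF y(1)] mv_times_tribe tribe_mv_simps(4)
            del: mv_multiple.simps)
      ultimately have "2 * y \<omega> = 1 / 2 ^ n" by (auto simp: min_def max_def split: if_splits)
      then show ?thesis by (simp add: field_simps)
    qed
    then have "(\<lambda>\<omega>\<in>\<Omega>. 1 / 2 ^ Suc n) = y" by (rule mem_eqI[OF y(1)])
    then show "(\<lambda>\<omega>\<in>\<Omega>. 1 / 2 ^ Suc n) \<in> \<F>" using y(1) by (simp only:)
  qed
qed

lemma dyadic_consts_iff_embeddable:
  "dyadic_consts \<longleftrightarrow> mv_embeddable dyadic_mv (tribe_mv \<Omega> \<F>)"
proof
  assume D: dyadic_consts
  define h where "h c = (\<lambda>\<omega>\<in>\<Omega>. c)" for c :: real
  have "x \<in> {0..1}" if x: "x \<in> carrier dyadic_mv" for x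
  proof -
    obtain i n :: nat where "x = real i / 2 ^ n" "i \<le> 2 ^ n"
      using x by (auto simp: dyadic_mv_def)
    moreover then have "real i \<le> 2 ^ n" using of_nat_mono[of i "2 ^ n"] by simp
    ultimately show ?thesis by simp
  qed
  then have "h \<in> carrier dyadic_mv \<rightarrow> \<F>"
    using const_mem[OF D] by (auto simp: h_def)
  then have "h \<in> mv_hom dyadic_mv (tribe_mv \<Omega> \<F>)"
    by (auto simp: mv_hom_def tribe_mv_simps) (simp_all add: dyadic_mv_def h_def cong: restrict_cong)
  moreover have "inj_on h (carrier dyadic_mv)"
  proof (rule inj_onI)
    fix x y assume "h x = h y"
    \<comment> \<open>A point of \<Omega> at which to evaluate is what separates distinct
      constants.\<close>
    moreover obtain \<omega> where "\<omega> \<in> \<Omega>" using nonempty by blast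
    ultimately show "x = y" unfolding h_def by (metis restrict_apply')
  qed
  ultimately show "mv_embeddable dyadic_mv (tribe_mv \<Omega> \<F>)"
    unfolding mv_embeddable_def by blast
next
  assume "mv_embeddable dyadic_mv (tribe_mv \<Omega> \<F>)"
  then obtain h where h: "h \<in> mv_hom dyadic_mv (tribe_mv \<Omega> \<F>)"
    unfolding mv_embeddable_def by blast
  have mem: "1 / 2 ^ Suc n \<in> carrier dyadic_mv" for n
  proof -
    have "1 / 2 ^ Suc n = real 1 / 2 ^ Suc n" "1 \<le> Suc n" "1 \<le> (2::nat) ^ Suc n" by simp_all
    then show ?thesis unfolding dyadic_mv_def partial_object.select_convs by blast
  qed
  have hF: "h (1 / 2 ^ Suc n) \<in> \<F>" for n
    using h mem[of n] by (auto simp: mv_hom_def tribe_mv_simps)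
  \<comment> \<open>The homomorphism must send these dyadics to the constants of the same value. The
    induction starts at 1/2, as 1/2 is the only real equal to its complement.\<close>
  have val: "\<forall>\<omega>\<in>\<Omega>. h (1 / 2 ^ Suc n) \<omega> = 1 / 2 ^ Suc n" for n
  proof (induction n)
    case 0
    have "h (mv_neg dyadic_mv (1 / 2)) = mv_neg (tribe_mv \<Omega> \<F>) (h (1 / 2))"
      using h mem[of 0] by (simp add: mv_hom_def)
    then have "h (1 / 2) = (\<lambda>\<omega>\<in>\<Omega>. 1 - h (1 / 2) \<omega>)"
      by (simp add: dyadic_mv_def tribe_mv_simps)
    then have "h (1 / 2) \<omega> = 1 - h (1 / 2) \<omega>" if "\<omega> \<in> \<Omega>" for \<omega>
      using that by (metis restrict_apply')
    then show ?case by force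
  next
    case (Suc n)
    let ?a = "1 / 2 ^ Suc (Suc n) :: real"
    have "h (mv_plus dyadic_mv ?a ?a) = mv_plus (tribe_mv \<Omega> \<F>) (h ?a) (h ?a)"
      using h mem[of "Suc n"] by (simp add: mv_hom_def)
    \<comment> \<open>A truncated sum strictly below 1 was not truncated, so doubling can be
      inverted. Starting from 1 instead, \<oplus> alone would give only a value at least
      1/2.\<close>
    moreover have less: "1 / 2 ^ Suc n < (1 :: real)"
      using one_less_power[of "2 :: real" "Suc n"] by (simp add: field_simps)
    then have "mv_plus dyadic_mv ?a ?a = 1 / 2 ^ Suc n"
      by (simp add: dyadic_mv_def min_def)
    ultimately have eq: "h (1 / 2 ^ Suc n) = (\<lambda>\<omega>\<in>\<Omega>. min (h ?a \<omega> + h ?a \<omega>) 1)"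
      by (simp only: tribe_mv_simps)
    show ?case
    proof
      fix \<omega> assume w: "\<omega> \<in> \<Omega>"
      have "min (h ?a \<omega> + h ?a \<omega>) 1 = 1 / 2 ^ Suc n"
        using fun_cong[OF eq, of \<omega>] w Suc by (simp del: power_Suc)
      then have "h ?a \<omega> + h ?a \<omega> = 1 / 2 ^ Suc n" using less by linarith
      then show "h ?a \<omega> = ?a" by simp
    qed
  qed
  show dyadic_consts
  proof (rule dyadic_constsI)
    fix n
    have "(\<lambda>\<omega>\<in>\<Omega>. 1 / 2 ^ Suc n) = h (1 / 2 ^ Suc n)"
      by (rule mem_eqI[OF hF]) (use val in simp)
    then show "(\<lambda>\<omega>\<in>\<Omega>. 1 / 2 ^ Suc n) \<in> \<F>" using hF by simp
  qed
qed

section \<open>Square root and strictness\<close>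

lemma square_root_tribe:
  assumes dyadic_consts
  shows "mv_square_root (tribe_mv \<Omega> \<F>) (\<lambda>f. \<lambda>\<omega>\<in>\<Omega>. (f \<omega> + 1) / 2)"
  unfolding mv_square_root_def mv_le_tribe mv_times_tribe tribe_mv_simps(1)
proof (intro conjI ballI impI)
  show "(\<lambda>f. \<lambda>\<omega>\<in>\<Omega>. (f \<omega> + 1) / 2) \<in> \<F> \<rightarrow> \<F>"
    using assms dyadic_consts_iff_sqrt by blast
next
  fix f assume f: "f \<in> \<F>"
  show "(\<lambda>\<omega>\<in>\<Omega>. max ((\<lambda>\<omega>\<in>\<Omega>. (f \<omega> + 1) / 2) \<omega> + (\<lambda>\<omega>\<in>\<Omega>. (f \<omega> + 1) / 2) \<omega> - 1) 0) = f"
    by (rule mem_eqI[OF f]) (use value_bounds(1)[OF f] in \<open>simp add: field_simps\<close>)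
next
  fix f g :: "'a \<Rightarrow> real" and \<omega>
  assume "\<forall>\<omega>\<in>\<Omega>. (\<lambda>\<omega>\<in>\<Omega>. max (g \<omega> + g \<omega> - 1) 0) \<omega> \<le> f \<omega>" "\<omega> \<in> \<Omega>"
  \<comment> \<open>Maximality of the root: 2 g - 1 \<le> f rearranges to g \<le> (f + 1) /
    2.\<close>
  then have "max (g \<omega> + g \<omega> - 1) 0 \<le> f \<omega>" by simp
  then show "g \<omega> \<le> (\<lambda>\<omega>\<in>\<Omega>. (f \<omega> + 1) / 2) \<omega>" using \<open>\<omega> \<in> \<Omega>\<close> by simp
qed

text \<open>The root of 0 is the constant 1/2, its own complement.\<close>

lemma strict_tribe:
  assumes dyadic_consts
  shows "mv_strict (tribe_mv \<Omega> \<F>)"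
  unfolding mv_strict_def
  by (rule exI, rule conjI[OF square_root_tribe[OF assms]])
    (simp add: tribe_mv_simps cong: restrict_cong)

end

theorem proposition5p9:
  fixes \<Omega> :: "'a set" and \<F> :: "('a \<Rightarrow> real) set"
  assumes "tribe \<Omega> \<F>"
  shows "let
      s = (\<lambda>f. \<lambda>\<omega>\<in>\<Omega>. (f \<omega> + 1) / 2);
      \<S> = tribe_sets \<Omega> \<F>;
      i = (\<forall>f\<in>\<F>. s f \<in> \<F>);
      ii = mv_embeddable dyadic_mv (tribe_mv \<Omega> \<F>);
      iii = (\<forall>c\<in>{0..1}. (\<lambda>\<omega>\<in>\<Omega>. c) \<in> \<F>);
      iv = (\<forall>f \<in> \<Omega> \<rightarrow>\<^sub>E {0..1}. f \<in> borel_measurable (sigma \<Omega> \<S>) \<longrightarrow> f \<in> \<F>);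
      v = mv_divisible (tribe_mv \<Omega> \<F>)
    in (i \<longleftrightarrow> ii) \<and> (ii \<longleftrightarrow> iii) \<and> (iii \<longleftrightarrow> iv) \<and> (iv \<longleftrightarrow> v) \<and>
       (i \<or> ii \<or> iii \<or> iv \<or> v \<longrightarrow>
          mv_square_root (tribe_mv \<Omega> \<F>) s \<and> mv_strict (tribe_mv \<Omega> \<F>))"
proof -
  interpret tribe \<Omega> \<F> by (fact assms)
  \<comment> \<open>Folding the equivalences turns all five statements into
    \<open>dyadic_consts\<close>, which leaves only the square root and strictness to
    supply.\<close>
  show ?thesis
    unfolding Let_def
      dyadic_consts_iff_sqrt[symmetric] dyadic_consts_iff_embeddable[symmetric]
      dyadic_consts_iff_const[symmetric] dyadic_consts_iff_measurable[symmetric]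
      dyadic_consts_iff_divisible[symmetric]
    using square_root_tribe strict_tribe by blast
qed

end
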